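(* Let $c>0$ and $\Delta=(0,c]$. Suppose that $F\in\mathcal S_\Delta\cap\mathcal D_\Delta$ is a distribution on $\mathbb R$. Then, for any $\varepsilon>0$, there exist $x_0=x_0(\varepsilon)>0$ and $c(\varepsilon)>0$ such that, for any $x>x_0$ and any integer $n\ge1$, $$F^{*n}(x+\Delta)\le c(\varepsilon)(1+\varepsilon)^nF(x+\Delta).$$
   Context: For $\Delta=(0,c]$ and a distribution $F$ on $\mathbb R$, $F(x+\Delta):=F((x,x+c])$. $F^{*n}$ is the $n$-fold convolution. $\alpha(x)\sim\beta(x)$ means $\alpha(x)/\beta(x)\to1$ as $x\to\infty$. The constant $c(\varepsilon)$ is unrelated to the length $c$ of $\Delta$. A non-negative measurable function $\alpha$ belongs to $\mathcal L$ if there is $x_0>0$ with $\alpha(x)>0$ for $x\ge x_0$ and, for every fixed $y>0$, $\alpha(x+y)\sim\alpha(x)$. $F\in\mathcal L_\Delta$ if $x\mapsto F(x+\Delta)$ is in $\mathcal L$; $F\in\mathcal S_\Delta$ if $F\in\mathcal L_\Delta$ and $F^{*2}(x+\Delta)\sim 2F(x+\Delta)$. A function $\alpha:\mathbb R\to\mathbb R_+$ is almost decreasing if there exist $x_0>0$ and $K>0$ such that $\alpha(x+y)\le K\alpha(x)$ for all $x>x_0$, $y>0$. $F\in\mathcal D_\Delta$ if $x\mapsto F(x+\Delta)$ is almost decreasing. *)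

theory Defs
  imports "HOL-Probability.Probability" "HOL-Library.Landau_Symbols"
begin

primrec conv_power :: "real measure \<Rightarrow> nat \<Rightarrow> real measure" where
  "conv_power F 0 = return borel 0"
| "conv_power F (Suc n) = convolution F (conv_power F n)"

text \<open>\<open>local_prob c F x\<close> is \<open>F(x + \<Delta>)\<close> for \<open>\<Delta> = (0, c]\<close>.\<close>

definition local_prob :: "real \<Rightarrow> real measure \<Rightarrow> real \<Rightarrow> real" where
  "local_prob c F x = measure F {x<..x + c}"

text \<open>The asymptotic equivalence of the library treats \<open>0/0\<close> as \<open>1\<close>; wherever it is used
  below, the denominator is eventually positive, so it says that the quotient tends to \<open>1\<close>.\<close>

definition class_L :: "(real \<Rightarrow> real) set" where
  "class_L = {\<alpha>. \<alpha> \<in> borel_measurable borel \<and> (\<forall>x. \<alpha> x \<ge> 0) \<and>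
     (\<exists>x0>0. \<forall>x\<ge>x0. \<alpha> x > 0) \<and>
     (\<forall>y>0. (\<lambda>x. \<alpha> (x + y)) \<sim>[at_top] \<alpha>)}"

definition almost_decreasing :: "(real \<Rightarrow> real) \<Rightarrow> bool" where
  "almost_decreasing \<alpha> \<longleftrightarrow> (\<forall>x. \<alpha> x \<ge> 0) \<and>
     (\<exists>x0>0. \<exists>K>0. \<forall>x>x0. \<forall>y>0. \<alpha> (x + y) \<le> K * \<alpha> x)"

definition L_Delta :: "real \<Rightarrow> real measure set" where
  "L_Delta c = {F. real_distribution F \<and> local_prob c F \<in> class_L}"

definition S_Delta :: "real \<Rightarrow> real measure set" where
  "S_Delta c = {F \<in> L_Delta c.
     local_prob c (conv_power F 2) \<sim>[at_top] (\<lambda>x. 2 * local_prob c F x)}"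

definition D_Delta :: "real \<Rightarrow> real measure set" where
  "D_Delta c = {F. real_distribution F \<and> almost_decreasing (local_prob c F)}"

lemma conv_power_1:
  assumes "real_distribution F"
  shows "conv_power F 1 = F"
proof -
  interpret F: real_distribution F by fact
  interpret R: prob_space "return borel (0::real)" by (rule prob_space_return) simp
  have f: "finite_measure F" "finite_measure (return borel (0::real))" by unfold_locales
  have "convolution F (return borel 0) = F"
  proof (rule measure_eqI)
    fix A assume "A \<in> sets (convolution F (return borel 0))"
    then have A: "A \<in> sets borel" by simp
    have "emeasure (convolution F (return borel 0)) A =
        (\<integral>\<^sup>+x. \<integral>\<^sup>+y. indicator A (x + y) \<partial>return borel 0 \<partial>F)"
      using A f by (intro convolution_emeasure') auto
    also have "\<dots> = (\<integral>\<^sup>+x. indicator A x \<partial>F)"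
      using A by (intro nn_integral_cong) (subst nn_integral_return, auto)
    also have "\<dots> = emeasure F A"
      using A by simp
    finally show "emeasure (convolution F (return borel 0)) A = emeasure F A" .
  qed simp
  then show ?thesis by simp
qed

lemma conv_power_2:
  assumes "real_distribution F"
  shows "conv_power F 2 = convolution F F"
  using conv_power_1[OF assms] by (simp add: numeral_2_eq_2)

end

theory Submission
  imports Defs
begin

text \<open>
  Write \<open>f n x\<close> for \<open>F\<^sup>*\<^sup>n(x + \<Delta>)\<close> and \<open>f = f 1\<close>. The proof is Kesten's recursion for the
  quotient \<open>f n x / f x\<close>, made to work on the whole line by splitting off the last summand.

  Let \<open>Y\<close> have law \<open>F\<close> and let \<open>S\<close>, independent of \<open>Y\<close>, have law \<open>F\<^sup>*\<^sup>n\<close>. Fix a level \<open>a\<close>. If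
  \<open>Y + S\<close> lies in \<open>(x, x + c]\<close>, then either \<open>Y < x - a\<close>, or \<open>Y \<ge> x - a\<close> and hence \<open>S \<le> a + c\<close>.

  In the first case the value \<open>x - Y\<close>, at which \<open>f n\<close> is evaluated, exceeds \<open>a\<close>, so an estimate
  \<open>f n z \<le> A * f z\<close> for \<open>z > a\<close> bounds the contribution by \<open>A\<close> times the same contribution
  for two summands with law \<open>F\<close>. That one is at most \<open>f 2 x\<close> minus the probability that the
  \<^emph>\<open>other\<close> summand is \<open>\<le> a\<close> and the sum lies in \<open>(x, x + c]\<close>. As \<open>f 2 \<sim> 2 f\<close>, and as the
  subtracted term is at least about \<open>F(-\<infinity>, a] * f x\<close> by long-tailedness and dominated
  convergence, what remains is at most \<open>(1 + \<epsilon>) * f x\<close> once \<open>a\<close> and \<open>x\<close> are large.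

  In the second case the factor \<open>f\<close> of \<open>Y\<close> is evaluated at \<open>x - S \<ge> x - a - c\<close>. Almost
  monotonicity and long-tailedness bound it by a constant times \<open>f x\<close>, and this constant does
  not depend on \<open>n\<close> because \<open>F\<^sup>*\<^sup>n\<close> has total mass one.

  For \<open>x\<close> in the remaining bounded range, \<open>f\<close> is bounded away from zero, while \<open>f n \<le> 1\<close>. So
  the best constants satisfy \<open>A (n + 1) \<le> (1 + \<epsilon>) * A n + B\<close> with \<open>B\<close> independent of \<open>n\<close>, which
  forces geometric growth of ratio \<open>1 + \<epsilon>\<close>. The recursion can start at \<open>n = 0\<close>, where \<open>f 0\<close>
  vanishes on the positive half-line.
\<close>

lemma real_distribution_conv_power:
  assumes "real_distribution F"
  shows "real_distribution (conv_power F n)"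
proof (induction n)
  case 0
  show ?case
    by (auto simp: real_distribution_def real_distribution_axioms_def intro: prob_space_return)
next
  case (Suc n)
  interpret F: real_distribution F by fact
  interpret G: real_distribution "conv_power F n" by fact
  interpret P: pair_prob_space F "conv_power F n" ..
  have "prob_space (conv_power F (Suc n))"
    unfolding conv_power.simps convolution_def by (rule P.prob_space_distr) simp
  then show ?case
    by (simp add: real_distribution_def real_distribution_axioms_def)
qed

lemma borel_measurable_local_prob [measurable]:
  assumes "real_distribution H" "c > 0"
  shows "local_prob c H \<in> borel_measurable borel"
proof -
  interpret H: real_distribution H by fact
  have [measurable]: "cdf H \<in> borel_measurable borel"
    by (intro borel_measurable_mono monoI H.cdf_nondecreasing)
  have "local_prob c H = (\<lambda>x. cdf H (x + c) - cdf H x)"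
    using \<open>c > 0\<close> by (simp add: fun_eq_iff local_prob_def H.cdf_diff_eq)
  then show ?thesis by simp
qed

lemma local_prob_nonneg: "0 \<le> local_prob c H x"
  by (simp add: local_prob_def)

lemma local_prob_le_1:
  assumes "real_distribution H"
  shows "local_prob c H x \<le> 1"
proof -
  interpret H: real_distribution H by fact
  show ?thesis by (simp add: local_prob_def)
qed

section \<open>Splitting a convolution\<close>

text \<open>
  For independent \<open>Y\<close>, \<open>S\<close> with laws \<open>G\<close>, \<open>H\<close> this is the probability that \<open>Y \<in> A\<close> and
  \<open>x < Y + S \<le> x + c\<close>. The form as an integral of \<open>local_prob\<close> lets pointwise bounds
  on local probabilities pass to it.
\<close>

definition restricted_conv ::
    "real \<Rightarrow> real measure \<Rightarrow> real measure \<Rightarrow> real set \<Rightarrow> real \<Rightarrow> real" where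
  "restricted_conv c G H A x = (\<integral>y. indicator A y * local_prob c H (x - y) \<partial>G)"

lemma integrable_restricted_conv:
  assumes "real_distribution G" "real_distribution H" "c > 0" "A \<in> sets borel"
  shows "integrable G (\<lambda>y. indicator A y * local_prob c H (x - y))"
proof -
  interpret G: real_distribution G by fact
  note [measurable] = borel_measurable_local_prob[OF assms(2,3)] assms(4)
  show ?thesis
    by (rule G.integrable_const_bound[where B=1])
       (auto simp: local_prob_nonneg local_prob_le_1[OF assms(2)] split: split_indicator)
qed

lemma restricted_conv_mono:
  assumes "real_distribution G" "real_distribution H" "real_distribution H'" "c > 0"
    and "A \<in> sets borel"
    and "\<And>y. y \<in> A \<Longrightarrow> local_prob c H (x - y) \<le> C * local_prob c H' (x - y)"
  shows "restricted_conv c G H A x \<le> C * restricted_conv c G H' A x"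
proof -
  have "restricted_conv c G H A x \<le> (\<integral>y. C * (indicator A y * local_prob c H' (x - y)) \<partial>G)"
    unfolding restricted_conv_def
    using assms
    by (intro integral_mono integrable_mult_right integrable_restricted_conv)
       (auto split: split_indicator)
  then show ?thesis by (simp add: restricted_conv_def)
qed

lemma restricted_conv_le_const:
  assumes "real_distribution G" "real_distribution H" "c > 0" "A \<in> sets borel" "0 \<le> C"
    and "\<And>y. y \<in> A \<Longrightarrow> local_prob c H (x - y) \<le> C"
  shows "restricted_conv c G H A x \<le> C"
proof -
  interpret G: real_distribution G by fact
  have "restricted_conv c G H A x \<le> (\<integral>y. C \<partial>G)"
    unfolding restricted_conv_def
    using assms
    by (intro integral_mono integrable_restricted_conv) (auto split: split_indicator)
  then show ?thesis using G.prob_space by simp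
qed

context
  fixes c :: real and G H :: "real measure"
  assumes c: "c > 0" and G: "real_distribution G" and H: "real_distribution H"
begin

interpretation G: real_distribution G by (rule G)
interpretation H: real_distribution H by (rule H)
interpretation P: pair_prob_space G H ..

lemma measure_pair_fst:
  assumes [measurable]: "A \<in> sets borel"
  shows "measure (G \<Otimes>\<^sub>M H) {(y, s). y \<in> A \<and> x < y + s \<and> y + s \<le> x + c}
    = restricted_conv c G H A x"
proof -
  let ?E = "{(y, s). y \<in> A \<and> x < y + s \<and> y + s \<le> x + c}"
  have "{z \<in> space (G \<Otimes>\<^sub>M H). fst z \<in> A \<and> x < fst z + snd z \<and> fst z + snd z \<le> x + c}
      \<in> sets (G \<Otimes>\<^sub>M H)"
    by measurable
  then have E: "?E \<in> sets (G \<Otimes>\<^sub>M H)"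
    by (simp add: space_pair_measure case_prod_unfold)
  have "emeasure H (Pair y -` ?E) = ennreal (indicator A y * local_prob c H (x - y))" for y
  proof (cases "y \<in> A")
    case True
    have "Pair y -` ?E = {x - y<..x - y + c}" using True by auto
    then show ?thesis using True by (simp add: local_prob_def H.emeasure_eq_measure)
  qed simp
  then have "emeasure (G \<Otimes>\<^sub>M H) ?E
      = (\<integral>\<^sup>+y. ennreal (indicator A y * local_prob c H (x - y)) \<partial>G)"
    using E by (simp add: H.emeasure_pair_measure_alt)
  also have "\<dots> = ennreal (restricted_conv c G H A x)"
    unfolding restricted_conv_def using assms
    by (intro nn_integral_eq_integral integrable_restricted_conv G H c)
       (auto simp: local_prob_nonneg)
  finally show ?thesis
    by (simp add: P.emeasure_eq_measure restricted_conv_def local_prob_nonneg)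
qed

lemma measure_pair_snd:
  assumes [measurable]: "A \<in> sets borel"
  shows "measure (G \<Otimes>\<^sub>M H) {(y, s). s \<in> A \<and> x < y + s \<and> y + s \<le> x + c}
    = restricted_conv c H G A x"
proof -
  let ?E = "{(y, s). s \<in> A \<and> x < y + s \<and> y + s \<le> x + c}"
  have "{z \<in> space (G \<Otimes>\<^sub>M H). snd z \<in> A \<and> x < fst z + snd z \<and> fst z + snd z \<le> x + c}
      \<in> sets (G \<Otimes>\<^sub>M H)"
    by measurable
  then have E: "?E \<in> sets (G \<Otimes>\<^sub>M H)"
    by (simp add: space_pair_measure case_prod_unfold)
  have "emeasure G ((\<lambda>y. (y, s)) -` ?E) = ennreal (indicator A s * local_prob c G (x - s))" for s
  proof (cases "s \<in> A")
    case True
    have "(\<lambda>y. (y, s)) -` ?E = {x - s<..x - s + c}" using True by auto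
    then show ?thesis using True by (simp add: local_prob_def G.emeasure_eq_measure)
  qed simp
  then have "emeasure (G \<Otimes>\<^sub>M H) ?E
      = (\<integral>\<^sup>+s. ennreal (indicator A s * local_prob c G (x - s)) \<partial>H)"
    using E by (simp add: P.emeasure_pair_measure_alt2)
  also have "\<dots> = ennreal (restricted_conv c H G A x)"
    unfolding restricted_conv_def using assms
    by (intro nn_integral_eq_integral integrable_restricted_conv G H c)
       (auto simp: local_prob_nonneg)
  finally show ?thesis
    by (simp add: P.emeasure_eq_measure restricted_conv_def local_prob_nonneg)
qed

lemma local_prob_convolution:
  "local_prob c (G \<star> H) x
    = measure (G \<Otimes>\<^sub>M H) {(y, s). x < y + s \<and> y + s \<le> x + c}"
proof -
  have "(\<lambda>(y, s). y + s) -` {x<..x + c} \<inter> space (G \<Otimes>\<^sub>M H)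
      = {(y, s). x < y + s \<and> y + s \<le> x + c}"
    by (auto simp: space_pair_measure)
  then show ?thesis
    unfolding local_prob_def convolution_def by (subst measure_distr) auto
qed

lemma sets_pair_split:
  assumes [measurable]: "A \<in> sets borel" "B \<in> sets borel"
  shows "{(y, s). y \<in> A \<and> s \<in> B \<and> x < y + s \<and> y + s \<le> x + c} \<in> sets (G \<Otimes>\<^sub>M H)"
proof -
  have "{z \<in> space (G \<Otimes>\<^sub>M H). fst z \<in> A \<and> snd z \<in> B \<and> x < fst z + snd z \<and> fst z + snd z \<le> x + c}
      \<in> sets (G \<Otimes>\<^sub>M H)"
    by measurable
  then show ?thesis
    by (simp add: space_pair_measure case_prod_unfold)
qed

text \<open>If the first summand is not below \<open>x - a\<close>, the second is at most \<open>a + c\<close>.\<close>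

lemma local_prob_convolution_le:
  "local_prob c (G \<star> H) x
    \<le> restricted_conv c G H {..<x - a} x + restricted_conv c H G {..a + c} x"
proof -
  let ?E = "{(y, s). y \<in> {..<x - a} \<and> x < y + s \<and> y + s \<le> x + c}"
  let ?D = "{(y, s). s \<in> {..a + c} \<and> x < y + s \<and> y + s \<le> x + c}"
  have m: "?E \<in> sets (G \<Otimes>\<^sub>M H)" "?D \<in> sets (G \<Otimes>\<^sub>M H)"
    using sets_pair_split[of "{..<x - a}" UNIV x] sets_pair_split[of UNIV "{..a + c}" x] by simp_all
  have "local_prob c (G \<star> H) x \<le> measure (G \<Otimes>\<^sub>M H) (?E \<union> ?D)"
    unfolding local_prob_convolution using m by (intro P.finite_measure_mono) auto
  also have "\<dots> \<le> measure (G \<Otimes>\<^sub>M H) ?E + measure (G \<Otimes>\<^sub>M H) ?D"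
    using m by (rule measure_Un_le)
  finally show ?thesis
    by (simp only: measure_pair_fst measure_pair_snd
        borel_open borel_closed open_lessThan closed_atMost)
qed

text \<open>The events on the left are disjoint: together they would force the sum below \<open>x\<close>.\<close>

lemma local_prob_convolution_ge:
  "restricted_conv c G H {..<x - a} x + restricted_conv c H G {..a} x
    \<le> local_prob c (G \<star> H) x"
proof -
  let ?E = "{(y, s). y \<in> {..<x - a} \<and> x < y + s \<and> y + s \<le> x + c}"
  let ?D = "{(y, s). s \<in> {..a} \<and> x < y + s \<and> y + s \<le> x + c}"
  have m: "?E \<in> sets (G \<Otimes>\<^sub>M H)" "?D \<in> sets (G \<Otimes>\<^sub>M H)"
    and m': "{(y, s). x < y + s \<and> y + s \<le> x + c} \<in> sets (G \<Otimes>\<^sub>M H)"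
    using sets_pair_split[of "{..<x - a}" UNIV x] sets_pair_split[of UNIV "{..a}" x]
      sets_pair_split[of UNIV UNIV x] by simp_all
  have "measure (G \<Otimes>\<^sub>M H) ?E + measure (G \<Otimes>\<^sub>M H) ?D = measure (G \<Otimes>\<^sub>M H) (?E \<union> ?D)"
    using m by (intro P.finite_measure_Union[symmetric]) auto
  also have "\<dots> \<le> local_prob c (G \<star> H) x"
    unfolding local_prob_convolution using m' by (intro P.finite_measure_mono) auto
  finally show ?thesis
    by (simp only: measure_pair_fst measure_pair_snd
        borel_open borel_closed open_lessThan closed_atMost)
qed

end

section \<open>Long-tailedness\<close>

text \<open>
  The definition of \<open>class_L\<close> only speaks of shifts to the right; a shift to the left
  is one to the right seen from the shifted point, with the quotient inverted.
\<close>

lemma class_L_shift_tendsto: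
  assumes "\<alpha> \<in> class_L"
  shows "((\<lambda>x. \<alpha> (x - u) / \<alpha> x) \<longlongrightarrow> 1) at_top"
proof -
  obtain x0 where pos: "\<And>x. x \<ge> x0 \<Longrightarrow> \<alpha> x > 0"
    and asymp: "\<And>y. y > 0 \<Longrightarrow> (\<lambda>x. \<alpha> (x + y)) \<sim>[at_top] \<alpha>"
    using assms unfolding class_L_def by blast
  have ev: "eventually (\<lambda>x. \<alpha> (x + y) \<noteq> 0 \<or> \<alpha> x \<noteq> 0) at_top" for y
    using eventually_ge_at_top[of x0] by eventually_elim (use pos in force)
  have right: "((\<lambda>x. \<alpha> (x + y) / \<alpha> x) \<longlongrightarrow> 1) at_top" if "y > 0" for y
    using asymp_equivD_strong[OF asymp[OF that] ev] .
  consider "u < 0" | "u = 0" | "u > 0" by linarith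
  then show ?thesis
  proof cases
    case 1
    then show ?thesis using right[of "-u"] by simp
  next
    case 2
    have "eventually (\<lambda>x. \<alpha> (x - u) / \<alpha> x = 1) at_top"
      using eventually_ge_at_top[of x0] by eventually_elim (use pos 2 in force)
    then show ?thesis by (rule tendsto_eventually)
  next
    case 3
    have "filterlim (\<lambda>x::real. x - u) at_top at_top"
      using filterlim_tendsto_add_at_top[OF tendsto_const filterlim_ident, of "-u"] by simp
    from tendsto_inverse[OF filterlim_compose[OF right[OF 3] this]]
    show ?thesis by simp
  qed
qed

text \<open>
  Truncating the quotient \<open>f (x - u) / f x\<close> at \<open>1\<close> loses nothing for a lower bound and supplies
  the dominating function.
\<close>

lemma eventually_restricted_conv_ge:
  assumes G: "real_distribution G" and H: "real_distribution H" and c: "c > 0"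
    and L: "local_prob c H \<in> class_L" and [measurable]: "A \<in> sets borel" and "\<delta> > 0"
  shows "eventually (\<lambda>x. (measure G A - \<delta>) * local_prob c H x \<le> restricted_conv c G H A x) at_top"
proof -
  interpret G: real_distribution G by fact
  note [measurable] = borel_measurable_local_prob[OF H c]
  let ?f = "local_prob c H"
  let ?s = "\<lambda>x u. indicator A u * min 1 (?f (x - u) / ?f x)"
  obtain x0 where pos: "\<And>x. x \<ge> x0 \<Longrightarrow> ?f x > 0"
    using L unfolding class_L_def by blast
  have s_bounds: "0 \<le> ?s x u" "?s x u \<le> 1" for x u
    by (auto simp: local_prob_nonneg split: split_indicator)
  have "((\<lambda>x. \<integral>u. ?s x u \<partial>G) \<longlongrightarrow> (\<integral>u. indicator A u \<partial>G)) at_top"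
  proof (rule integral_dominated_convergence_at_top[where w="\<lambda>_. 1"])
    show "AE u in G. ((\<lambda>x. ?s x u) \<longlongrightarrow> indicator A u) at_top"
    proof (rule AE_I2)
      fix u
      have "((\<lambda>x. ?s x u) \<longlongrightarrow> indicator A u * min 1 1) at_top"
        by (intro tendsto_intros class_L_shift_tendsto L)
      then show "((\<lambda>x. ?s x u) \<longlongrightarrow> indicator A u) at_top" by simp
    qed
    show "\<forall>\<^sub>F x in at_top. AE u in G. norm (?s x u) \<le> 1"
      using s_bounds by (intro always_eventually allI AE_I2) (simp add: abs_le_iff order_trans[OF _ s_bounds(1)])
  qed auto
  then have "eventually (\<lambda>x. (\<integral>u. ?s x u \<partial>G) > measure G A - \<delta>) at_top"
    using \<open>\<delta> > 0\<close> by (intro order_tendstoD) auto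
  then show ?thesis
    using eventually_ge_at_top[of x0]
  proof eventually_elim
    case (elim x)
    then have fx: "?f x > 0" using pos by blast
    have "(measure G A - \<delta>) * ?f x \<le> (\<integral>u. ?s x u \<partial>G) * ?f x"
      using elim fx by (intro mult_right_mono) auto
    also have "\<dots> = (\<integral>u. ?s x u * ?f x \<partial>G)"
      by simp
    also have "\<dots> \<le> restricted_conv c G H A x"
      unfolding restricted_conv_def
    proof (rule integral_mono)
      show "integrable G (\<lambda>u. ?s x u * ?f x)"
        using s_bounds
        by (intro integrable_mult_left G.integrable_const_bound[where B=1])
           (auto simp: abs_le_iff order_trans[OF _ s_bounds(1)])
      show "?s x u * ?f x \<le> indicator A u * ?f (x - u)" for u
        using fx by (auto simp: min_def field_simps split: split_indicator)
    qed (intro integrable_restricted_conv G H c assms)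
    finally show ?case .
  qed
qed

section \<open>Kesten's bound\<close>

text \<open>
  With the level \<open>a\<close> fixed so that \<open>F(-\<infinity>, a]\<close> is close to one, the term \<open>2\<close> from \<open>f 2 \<sim> 2 f\<close>
  splits into a part close to one, from the summand that is at most \<open>a\<close>, and the part here.
\<close>

lemma eventually_restricted_conv_lessThan_le:
  assumes c: "c > 0" and S: "F \<in> S_Delta c" and "\<epsilon> > 0" and a: "measure F {..a} \<ge> 1 - \<epsilon> / 4"
  shows "eventually (\<lambda>x. restricted_conv c F F {..<x - a} x \<le> (1 + \<epsilon>) * local_prob c F x) at_top"
proof -
  let ?f = "local_prob c F"
  have F: "real_distribution F" and L: "?f \<in> class_L"
    and two: "local_prob c (conv_power F 2) \<sim>[at_top] (\<lambda>x. 2 * ?f x)"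
    using S by (auto simp: S_Delta_def L_Delta_def)
  obtain x0 where pos: "\<And>x. x \<ge> x0 \<Longrightarrow> ?f x > 0"
    using L unfolding class_L_def by blast
  have "eventually (\<lambda>x. local_prob c (F \<star> F) x \<noteq> 0 \<or> 2 * ?f x \<noteq> 0) at_top"
    using eventually_ge_at_top[of x0] by eventually_elim (use pos in force)
  then have "((\<lambda>x. local_prob c (F \<star> F) x / (2 * ?f x)) \<longlongrightarrow> 1) at_top"
    using two unfolding conv_power_2[OF F] by (intro asymp_equivD_strong)
  then have "eventually (\<lambda>x. local_prob c (F \<star> F) x / (2 * ?f x) < 1 + \<epsilon> / 4) at_top"
    using \<open>\<epsilon> > 0\<close> by (intro order_tendstoD) auto
  moreover have "eventually (\<lambda>x. (measure F {..a} - \<epsilon> / 4) * ?f x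
      \<le> restricted_conv c F F {..a} x) at_top"
    using \<open>\<epsilon> > 0\<close> by (intro eventually_restricted_conv_ge F c L) auto
  ultimately show ?thesis
    using eventually_ge_at_top[of x0]
  proof eventually_elim
    case (elim x)
    then have fx: "?f x > 0" using pos by blast
    have "local_prob c (F \<star> F) x \<le> (2 + \<epsilon> / 2) * ?f x"
      using elim(1) fx by (simp add: field_simps)
    moreover have "(1 - \<epsilon> / 2) * ?f x \<le> (measure F {..a} - \<epsilon> / 4) * ?f x"
      using a fx by (intro mult_right_mono) auto
    moreover have "restricted_conv c F F {..<x - a} x + restricted_conv c F F {..a} x
        \<le> local_prob c (F \<star> F) x"
      by (rule local_prob_convolution_ge[OF c F F])
    ultimately show ?case
      using elim(2) by (simp add: algebra_simps)
  qed
qed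

text \<open>
  At \<open>x - b\<close> and to the right of it, almost monotonicity bounds \<open>f\<close> by its value at that single
  point, which long-tailedness compares with \<open>f x\<close>. Both the constant and the range of \<open>x\<close> must
  be uniform in \<open>H\<close>, since \<open>H\<close> will run through all convolution powers.
\<close>

lemma eventually_restricted_conv_atMost_le:
  assumes c: "c > 0" and F: "real_distribution F"
    and L: "local_prob c F \<in> class_L" and D: "almost_decreasing (local_prob c F)"
  obtains K where "K > 0"
    and "eventually (\<lambda>x. \<forall>H. real_distribution H \<longrightarrow>
      restricted_conv c H F {..b} x \<le> K * local_prob c F x) at_top"
proof -
  let ?f = "local_prob c F"
  obtain xd K0 where K0: "K0 > 0" and dec0: "\<And>x y. x > xd \<Longrightarrow> y > 0 \<Longrightarrow> ?f (x + y) \<le> K0 * ?f x"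
    using D unfolding almost_decreasing_def by blast
  \<comment> \<open>A factor at least one covers the increment zero as well.\<close>
  define K where "K = max 1 K0"
  have dec: "?f z \<le> K * ?f x" if "x > xd" "x \<le> z" for x z
  proof (cases "x = z")
    case True
    then show ?thesis using mult_right_mono[of 1 K "?f z"] by (simp add: K_def local_prob_nonneg)
  next
    case False
    then have "?f z \<le> K0 * ?f x" using dec0[of x "z - x"] that by simp
    also have "\<dots> \<le> K * ?f x" by (intro mult_right_mono) (auto simp: K_def local_prob_nonneg)
    finally show ?thesis .
  qed
  obtain x0 where pos: "\<And>x. x \<ge> x0 \<Longrightarrow> ?f x > 0"
    using L unfolding class_L_def by blast
  have "eventually (\<lambda>x. ?f (x - b) / ?f x < 2) at_top"
    using class_L_shift_tendsto[OF L, of b] by (intro order_tendstoD) auto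
  then have "eventually (\<lambda>x. \<forall>H. real_distribution H \<longrightarrow>
      restricted_conv c H F {..b} x \<le> 2 * K * ?f x) at_top"
    using eventually_ge_at_top[of x0] eventually_gt_at_top[of "xd + b"]
  proof eventually_elim
    case (elim x)
    then have fx: "?f x > 0" using pos by blast
    have "?f (x - s) \<le> 2 * K * ?f x" if "s \<le> b" for s
    proof -
      have "?f (x - s) \<le> K * ?f (x - b)" using elim that by (intro dec) auto
      also have "\<dots> \<le> K * (2 * ?f x)"
        using elim fx by (intro mult_left_mono) (auto simp: K_def field_simps)
      finally show ?thesis by simp
    qed
    then show ?case
      using fx by (intro allI impI restricted_conv_le_const F c) (auto simp: K_def)
  qed
  then show thesis by (rule that[rotated]) (simp add: K_def)
qed

text \<open>
  This is where almost monotonicity replaces local regularity of \<open>f\<close>: on a bounded interval, \<open>f\<close>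
  is controlled from below by its value at the right end point.
\<close>

lemma almost_decreasing_class_L_bounded_below:
  assumes "\<alpha> \<in> class_L" "almost_decreasing \<alpha>"
  obtains x0 where "x0 > 0" and "\<And>b. \<exists>m>0. \<forall>x. x0 < x \<and> x < b \<longrightarrow> m \<le> \<alpha> x"
proof -
  obtain x1 where pos: "\<And>x. x \<ge> x1 \<Longrightarrow> \<alpha> x > 0"
    using assms(1) unfolding class_L_def by blast
  obtain x0 K where "x0 > 0" "K > 0" and dec: "\<And>x y. x > x0 \<Longrightarrow> y > 0 \<Longrightarrow> \<alpha> (x + y) \<le> K * \<alpha> x"
    using assms(2) unfolding almost_decreasing_def by blast
  show thesis
  proof (rule that[OF \<open>x0 > 0\<close>])
    fix b
    have "\<alpha> (max b x1) / K \<le> \<alpha> x" if "x0 < x" "x < b" for x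
      using dec[of x "max b x1 - x"] that \<open>K > 0\<close> by (simp add: field_simps)
    moreover have "\<alpha> (max b x1) / K > 0"
      using pos[of "max b x1"] \<open>K > 0\<close> by simp
    ultimately show "\<exists>m>0. \<forall>x. x0 < x \<and> x < b \<longrightarrow> m \<le> \<alpha> x" by blast
  qed
qed

theorem proposition3p10:
  fixes c :: real and F :: "real measure"
  assumes "c > 0"
    and "real_distribution F"
    and "F \<in> S_Delta c \<inter> D_Delta c"
  shows "\<forall>\<epsilon>>0. \<exists>x0>0. \<exists>C>0. \<forall>x>x0. \<forall>n\<ge>1.
    local_prob c (conv_power F n) x \<le> C * (1 + \<epsilon>) ^ n * local_prob c F x"
proof (intro allI impI)
  fix \<epsilon> :: real
  assume \<epsilon>: "\<epsilon> > 0"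
  note c = assms(1) and F = assms(2)
  interpret F: real_distribution F by (rule F)
  let ?f = "local_prob c F"
  let ?F = "\<lambda>n. conv_power F n"
  note Fn = real_distribution_conv_power[OF F]
  have S: "F \<in> S_Delta c" and L: "?f \<in> class_L" and D: "almost_decreasing ?f"
    using assms(3) by (auto simp: S_Delta_def L_Delta_def D_Delta_def)
  obtain xb where "xb > 0" and below: "\<And>b. \<exists>m>0. \<forall>x. xb < x \<and> x < b \<longrightarrow> m \<le> ?f x"
    using almost_decreasing_class_L_bounded_below[OF L D] by blast
  obtain a where a: "a \<ge> xb" "measure F {..a} \<ge> 1 - \<epsilon> / 4"
  proof -
    have "eventually (\<lambda>a. cdf F a > 1 - \<epsilon> / 4) at_top"
      using F.cdf_lim_at_top_prob \<epsilon> by (intro order_tendstoD) auto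
    then have "eventually (\<lambda>a. xb \<le> a \<and> cdf F a > 1 - \<epsilon> / 4) at_top"
      using eventually_ge_at_top[of xb] by eventually_elim simp
    then obtain a where "xb \<le> a" "cdf F a > 1 - \<epsilon> / 4"
      by (auto simp: eventually_at_top_linorder)
    then show thesis using that[of a] by (simp add: cdf_def)
  qed
  obtain K where K: "K > 0"
    and far_ev: "eventually (\<lambda>x. \<forall>H. real_distribution H \<longrightarrow>
      restricted_conv c H F {..a + c} x \<le> K * ?f x) at_top"
    using eventually_restricted_conv_atMost_le[OF c F L D] by blast
  have "eventually (\<lambda>x. restricted_conv c F F {..<x - a} x \<le> (1 + \<epsilon>) * ?f x \<and>
      (\<forall>H. real_distribution H \<longrightarrow> restricted_conv c H F {..a + c} x \<le> K * ?f x)) at_top"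
    using eventually_restricted_conv_lessThan_le[OF c S \<epsilon> a(2)] far_ev by (rule eventually_conj)
  then obtain b where near: "\<And>x. x \<ge> b \<Longrightarrow> restricted_conv c F F {..<x - a} x \<le> (1 + \<epsilon>) * ?f x"
    and far: "\<And>x H. x \<ge> b \<Longrightarrow> real_distribution H \<Longrightarrow>
      restricted_conv c H F {..a + c} x \<le> K * ?f x"
    by (auto simp: eventually_at_top_linorder)
  obtain m where m: "m > 0" "\<And>x. a < x \<Longrightarrow> x < b \<Longrightarrow> m \<le> ?f x"
    using below[of b] a(1) by force
  define B where "B = K + 1 / m"
  have B: "B > 0" using K m(1) by (auto simp: B_def intro: add_pos_pos)
  \<comment> \<open>The solution with initial value \<open>1\<close> of the recursion \<open>A (n + 1) = (1 + \<epsilon>) * A n + B\<close>.\<close>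
  define A where "A n = (1 + B / \<epsilon>) * (1 + \<epsilon>) ^ n - B / \<epsilon>" for n :: nat
  have A_Suc: "A (Suc n) = A n * (1 + \<epsilon>) + B" for n
    using \<epsilon> by (simp add: A_def field_simps)
  have A_nonneg: "0 \<le> A n" for n
    by (induction n) (use \<epsilon> B in \<open>simp add: A_def, simp add: A_Suc\<close>)
  have main: "local_prob c (?F n) x \<le> A n * ?f x" if "x > a" for x n
    using that
  proof (induction n arbitrary: x)
    case 0
    then have "local_prob c (?F 0) x = 0"
      using a \<open>xb > 0\<close> by (simp add: local_prob_def measure_return)
    then show ?case using A_nonneg[of 0] by (simp add: local_prob_nonneg)
  next
    case (Suc n)
    show ?case
    proof (cases "x < b")
      case True
      have "local_prob c (?F (Suc n)) x \<le> 1"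
        by (rule local_prob_le_1[OF Fn])
      also have "\<dots> \<le> 1 / m * ?f x"
        using m(2)[OF Suc.prems True] m(1) by (simp add: field_simps)
      also have "\<dots> \<le> A (Suc n) * ?f x"
        unfolding A_Suc using A_nonneg[of n] \<epsilon> K
        by (intro mult_right_mono) (auto simp: B_def local_prob_nonneg)
      finally show ?thesis .
    next
      case False
      have "local_prob c (?F (Suc n)) x
          \<le> restricted_conv c F (?F n) {..<x - a} x + restricted_conv c (?F n) F {..a + c} x"
        using local_prob_convolution_le[OF c F Fn] by simp
      also have "restricted_conv c (?F n) F {..a + c} x \<le> K * ?f x"
        using False by (intro far Fn) auto
      also have "restricted_conv c F (?F n) {..<x - a} x
          \<le> A n * restricted_conv c F F {..<x - a} x"
        by (intro restricted_conv_mono F Fn c Suc.IH) auto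
      also have "\<dots> \<le> A n * ((1 + \<epsilon>) * ?f x)"
        using False by (intro mult_left_mono near A_nonneg) auto
      finally have "local_prob c (?F (Suc n)) x \<le> (A n * (1 + \<epsilon>) + K) * ?f x"
        by (simp add: algebra_simps)
      also have "\<dots> \<le> A (Suc n) * ?f x"
        unfolding A_Suc using m(1) by (intro mult_right_mono) (auto simp: B_def local_prob_nonneg)
      finally show ?thesis .
    qed
  qed
  have "local_prob c (?F n) x \<le> (1 + B / \<epsilon>) * (1 + \<epsilon>) ^ n * ?f x" if "x > a" for x n
  proof -
    have "A n * ?f x \<le> (1 + B / \<epsilon>) * (1 + \<epsilon>) ^ n * ?f x"
      using \<epsilon> B by (intro mult_right_mono) (auto simp: A_def local_prob_nonneg)
    then show ?thesis using main[OF that] by (rule order_trans[rotated])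
  qed
  moreover have "a > 0" "1 + B / \<epsilon> > 0"
    using a \<open>xb > 0\<close> \<epsilon> B by (auto intro: add_pos_pos)
  ultimately show "\<exists>x0>0. \<exists>C>0. \<forall>x>x0. \<forall>n\<ge>1.
      local_prob c (conv_power F n) x \<le> C * (1 + \<epsilon>) ^ n * ?f x"
    by blast
qed

end
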